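(* Let $G$ be a graph with (exactly) $l$ universal vertices, let $\overline{G}$ be its complement, and let $M(G)$ be the Mycielski graph of $G$. Then $$\mathrm{box}(M(G))\leq \theta(\overline{G})+\left\lceil \frac{l}{2}\right\rceil+1 .$$ If moreover $l$ is zero or odd, then $$\mathrm{box}(M(G))\leq \theta(\overline{G})+\left\lceil \frac{l}{2}\right\rceil .$$
   Context: All graphs are finite, simple and undirected. A vertex $v$ of $G$ is universal if $v$ is adjacent to all vertices in $V(G)\setminus\{v\}$. $\lceil x\rceil$ denotes the smallest integer at least $x$. A clique of a graph $H$ is a subset of $V(H)$ that induces a complete subgraph. The edge clique cover number $\theta(H)$ is the minimum cardinality of a family of cliques of $H$ that covers all edges of $H$ (each edge has both endpoints in some clique of the family); it is $0$ if $H$ has no edges. Boxicity: a box in Euclidean $k$-space is a Cartesian product $I_1\times\cdots\times I_k$ where each $I_j$ is a closed interval on the real line. The boxicity $\mathrm{box}(G)$ is the minimum nonnegative integer $k$ such that $G$ can be represented as the intersection graph of a family of boxes $(B_v)_{v\in V(G)}$ in Euclidean $k$-space, i.e. for distinct vertices $u,v$, $uv\in E(G)$ if and only if $B_u\cap B_v\neq\emptyset$. The boxicity of a complete graph is defined to be $0$. Mycielski graph: let $V(G)_1,V(G)_2$ be two disjoint copies of $V(G)$, where $v_i\in V(G)_i$ denotes the copy of $v\in V(G)$, and let $z$ be a new vertex. $M(G)$ has vertex set $\{z\}\cup V(G)_1\cup V(G)_2$ (disjoint union) and edge set $E_1\cup E_2\cup E_3$, where $E_1=\{u_1v_1 \mid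 uv\in E(G)\}$, $E_2=\{u_1v_2,\, v_1u_2 \mid uv\in E(G)\}$, $E_3=\{zu_2\mid u\in V(G)\}$. *)

theory Defs
  imports Complex_Main "HOL-Library.FuncSet" "Graph_Theory.Pair_Digraph"
begin

text \<open>
  A finite simple undirected graph is a \<^locale>\<open>pair_graph\<close>: a finite vertex set together with
  a symmetric, irreflexive arc relation, an undirected edge being represented by its two
  orientations.
\<close>

definition universal_vertices :: "'a pair_pre_digraph \<Rightarrow> 'a set" where
  "universal_vertices G = {v \<in> pverts G. \<forall>u \<in> pverts G - {v}. (v, u) \<in> parcs G}"

definition complement :: "'a pair_pre_digraph \<Rightarrow> 'a pair_pre_digraph" where
  "complement G = \<lparr> pverts = pverts G,
     parcs = {(u, v). u \<in> pverts G \<and> v \<in> pverts G \<and> u \<noteq> v \<and> (u, v) \<notin> parcs G} \<rparr>"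

definition clique :: "'a pair_pre_digraph \<Rightarrow> 'a set \<Rightarrow> bool" where
  "clique H C \<longleftrightarrow> C \<subseteq> pverts H \<and> (\<forall>u \<in> C. \<forall>v \<in> C. u \<noteq> v \<longrightarrow> (u, v) \<in> parcs H)"

definition edge_clique_cover :: "'a pair_pre_digraph \<Rightarrow> 'a set set \<Rightarrow> bool" where
  "edge_clique_cover H F \<longleftrightarrow> finite F \<and> (\<forall>C \<in> F. clique H C) \<and>
     (\<forall>(u, v) \<in> parcs H. \<exists>C \<in> F. u \<in> C \<and> v \<in> C)"

definition edge_clique_cover_number :: "'a pair_pre_digraph \<Rightarrow> nat" where
  "edge_clique_cover_number H = (LEAST n. \<exists>F. edge_clique_cover H F \<and> card F = n)"

text \<open>
  Points of Euclidean \<open>k\<close>-space are the extensional functions on \<open>{..<k}\<close>, so that \<open>k\<close> can be an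
  ordinary natural number. The \<open>0\<close>-dimensional space has exactly one point, which is its only box.
\<close>

definition is_box :: "nat \<Rightarrow> (nat \<Rightarrow> real) set \<Rightarrow> bool" where
  "is_box k B \<longleftrightarrow> (\<exists>a b. (\<forall>j<k. a j \<le> b j) \<and> B = (\<Pi>\<^sub>E j\<in>{..<k}. {a j..b j}))"

definition box_representation ::
    "'a pair_pre_digraph \<Rightarrow> nat \<Rightarrow> ('a \<Rightarrow> (nat \<Rightarrow> real) set) \<Rightarrow> bool" where
  "box_representation G k B \<longleftrightarrow> (\<forall>v \<in> pverts G. is_box k (B v)) \<and>
     (\<forall>u \<in> pverts G. \<forall>v \<in> pverts G. u \<noteq> v \<longrightarrow> ((u, v) \<in> parcs G \<longleftrightarrow> B u \<inter> B v \<noteq> {}))"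

text \<open>
  The convention that complete graphs have boxicity \<open>0\<close> needs no separate clause; see
  \<open>boxicity_complete\<close> below.
\<close>

definition boxicity :: "'a pair_pre_digraph \<Rightarrow> nat" where
  "boxicity G = (LEAST k. \<exists>B. box_representation G k B)"

datatype 'a mycielski_vertex = Apex | Copy1 'a | Copy2 'a

definition mycielski :: "'a pair_pre_digraph \<Rightarrow> 'a mycielski_vertex pair_pre_digraph" where
  "mycielski G = \<lparr>
     pverts = {Apex} \<union> Copy1 ` pverts G \<union> Copy2 ` pverts G,
     parcs = {(Copy1 u, Copy1 v) | u v. (u, v) \<in> parcs G}
       \<union> ({(Copy1 u, Copy2 v) | u v. (u, v) \<in> parcs G}
          \<union> {(Copy2 u, Copy1 v) | u v. (u, v) \<in> parcs G})
       \<union> ({(Apex, Copy2 u) | u. u \<in> pverts G} \<union> {(Copy2 u, Apex) | u. u \<in> pverts G}) \<rparr>"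

lemma pair_graph_complement:
  assumes "pair_graph G" shows "pair_graph (complement G)"
proof -
  interpret pair_graph G by fact
  show ?thesis
  proof
    show "finite (parcs (complement G))"
      by (rule finite_subset[of _ "pverts G \<times> pverts G"]) (auto simp: complement_def)
  qed (auto simp: complement_def symmetric_def intro!: symI dest: arcs_symmetric)
qed

lemma pair_graph_mycielski:
  assumes "pair_graph G" shows "pair_graph (mycielski G)"
proof -
  interpret pair_graph G by fact
  have *: "pair_wf_digraph (mycielski G)"
    by unfold_locales (auto simp: mycielski_def dest: in_arcsD1 in_arcsD2)
  then interpret M: pair_wf_digraph "mycielski G" .
  show ?thesis
  proof
    show fin: "finite (pverts (mycielski G))" by (simp add: mycielski_def)
    show "finite (parcs (mycielski G))"
      by (rule finite_subset[of _ "pverts (mycielski G) \<times> pverts (mycielski G)"])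
        (use fin in \<open>auto dest: M.in_arcsD1 M.in_arcsD2\<close>)
  qed (auto simp: mycielski_def symmetric_def intro!: symI dest: arcs_symmetric no_loops')
qed

lemma edge_clique_cover_exists:
  assumes "pair_graph H" shows "\<exists>F. edge_clique_cover H F"
proof -
  interpret pair_graph H by fact
  have "edge_clique_cover H ((\<lambda>(u, v). {u, v}) ` parcs H)"
    by (auto simp: edge_clique_cover_def clique_def dest: in_arcsD1 in_arcsD2 arcs_symmetric)
  then show ?thesis ..
qed

lemma box_representation_exists:
  assumes "pair_graph G" shows "\<exists>k B. box_representation G k B"
proof -
  interpret pair_graph G by fact
  obtain f where f: "bij_betw f {..<card (pverts G)} (pverts G)"
    using ex_bij_betw_nat_finite[OF pair_finite_verts] by (auto simp: atLeast0LessThan)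
  define a b :: "'a \<Rightarrow> nat \<Rightarrow> real"
    where "a v j = (if v = f j \<or> (v, f j) \<in> parcs G then 0 else 1)"
      and "b v j = (if v = f j then 0 else 1)" for v j
  let ?I = "{..<card (pverts G)}"
  define B where "B v = (\<Pi>\<^sub>E j\<in>?I. {a v j..b v j})" for v
  have "(u, v) \<in> parcs G \<longleftrightarrow> B u \<inter> B v \<noteq> {}"
    if uv: "u \<in> pverts G" "v \<in> pverts G" "u \<noteq> v" for u v
  proof -
    have eq: "B u \<inter> B v = (\<Pi>\<^sub>E j\<in>?I. {a u j..b u j} \<inter> {a v j..b v j})"
      by (simp add: B_def PiE_Int)
    have "{a u j..b u j} \<inter> {a v j..b v j} \<noteq> {}" if "(u, v) \<in> parcs G" for j
      using that uv(3) by (auto simp: a_def b_def dest: arcs_symmetric)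
    moreover have "\<exists>j\<in>?I. {a u j..b u j} \<inter> {a v j..b v j} = {}" if "(u, v) \<notin> parcs G"
    proof -
      have "v \<in> f ` ?I" using f uv(2) by (simp add: bij_betw_def)
      then obtain j where "j \<in> ?I" "f j = v" by blast
      then have "{a u j..b u j} \<inter> {a v j..b v j} = {}"
        using that uv(3) by (auto simp: a_def b_def)
      then show ?thesis using \<open>j \<in> ?I\<close> by blast
    qed
    ultimately show ?thesis by (cases "(u, v) \<in> parcs G") (simp_all add: eq PiE_eq_empty_iff)
  qed
  moreover have "is_box (card (pverts G)) (B v)" for v
    unfolding is_box_def B_def
    by (rule exI[of _ "a v"], rule exI[of _ "b v"]) (simp add: a_def b_def)
  ultimately have "box_representation G (card (pverts G)) B"
    unfolding box_representation_def by blast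
  then show ?thesis by blast
qed

lemma boxicity_complete:
  assumes "clique G (pverts G)" shows "boxicity G = 0"
proof -
  have "box_representation G 0 (\<lambda>_. {\<lambda>_. undefined})"
    using assms by (auto simp: box_representation_def is_box_def clique_def)
  then have "\<exists>B. box_representation G 0 B" by blast
  then show ?thesis unfolding boxicity_def by (rule Least_eq_0)
qed

end

theory Submission
  imports Defs
begin

text \<open>
  A box representation in dimension \<open>k\<close> is the same thing as \<open>k\<close> interval representations of
  supergraphs of the given graph such that every non-edge is a non-edge of at least one of these
  supergraphs. It therefore suffices to exhibit few interval supergraphs of \<open>M(G)\<close> that together
  destroy all its non-edges, namely \<open>z u\<^sub>1\<close>; \<open>u\<^sub>1 v\<^sub>1\<close> for distinct non-adjacent \<open>u, v\<close>;
  \<open>u\<^sub>1 v\<^sub>2\<close> for equal or non-adjacent \<open>u, v\<close>; and \<open>u\<^sub>2 v\<^sub>2\<close> for distinct \<open>u, v\<close>.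

  Cliques of the complement of \<open>G\<close> are stable sets of \<open>G\<close>. A stable set \<open>S\<close> yields one interval
  supergraph (\<open>interval_supergraph_stable\<close>) in which the vertices \<open>u\<^sub>1\<close> with \<open>u \<in> S\<close> are points to
  the right of \<open>0\<close>, the vertices \<open>u\<^sub>2\<close> with \<open>u \<in> S\<close> are points to the left of \<open>0\<close>, and \<open>z\<close> lives on
  the left. This destroys every non-edge that comes from a non-edge of \<open>G\<close> inside \<open>S\<close>, and also
  \<open>z u\<^sub>1\<close>, \<open>u\<^sub>1 u\<^sub>2\<close> and \<open>u\<^sub>2 v\<^sub>2\<close> for all \<open>u \<in> S\<close> and all \<open>v \<noteq> u\<close>. A vertex of \<open>G\<close> that is not universal
  lies on an edge of the complement, hence in some member of any edge clique cover. So
  \<open>\<theta>\<close> supergraphs leave only the non-edges \<open>u\<^sub>1 u\<^sub>2\<close>, \<open>z u\<^sub>1\<close> and \<open>u\<^sub>2 v\<^sub>2\<close> with \<open>u\<close> and \<open>v\<close> universal;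
  in particular nothing is left when \<open>l = 0\<close>.

  If \<open>l > 0\<close>, group the universal vertices into \<open>\<lfloor>l/2\<rfloor>\<close> pairs with at most one vertex \<open>w\<close> left
  over. One supergraph per pair \<open>p, q\<close> (\<open>interval_supergraph_pair\<close>) destroys \<open>p\<^sub>1 p\<^sub>2\<close>, \<open>q\<^sub>1 q\<^sub>2\<close> and
  every pair of second copies that involves \<open>p\<^sub>2\<close> or \<open>q\<^sub>2\<close>. One last supergraph
  (\<open>interval_supergraph_apex\<close>) destroys all \<open>z u\<^sub>1\<close> and \<open>w\<^sub>1 w\<^sub>2\<close> simultaneously. The total is
  \<open>\<theta> + \<lfloor>l/2\<rfloor> + 1\<close>, which is \<open>\<theta> + \<lceil>l/2\<rceil>\<close> for odd \<open>l\<close> and \<open>\<theta> + \<lceil>l/2\<rceil> + 1\<close> for even \<open>l\<close>.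
\<close>

section \<open>Boxicity and interval supergraphs\<close>

text \<open>
  A vertex is assigned the pair of end points of its interval. For arcs only one of the two
  inequalities that make intervals meet is demanded, since the reversed arc supplies the other.
\<close>

definition interval_supergraph :: "'v pair_pre_digraph \<Rightarrow> ('v \<Rightarrow> real \<times> real) \<Rightarrow> bool" where
  "interval_supergraph H J \<longleftrightarrow> (\<forall>v \<in> pverts H. fst (J v) \<le> snd (J v)) \<and>
     (\<forall>(u, v) \<in> parcs H. fst (J u) \<le> snd (J v))"

definition separates :: "('v \<Rightarrow> real \<times> real) \<Rightarrow> 'v \<Rightarrow> 'v \<Rightarrow> bool" where
  "separates J u v \<longleftrightarrow> snd (J u) < fst (J v) \<or> snd (J v) < fst (J u)"

lemma separates_sym: "separates J u v \<longleftrightarrow> separates J v u"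
  by (auto simp: separates_def)

text \<open>
  The supergraphs serve as the coordinates: two boxes meet exactly if their projections meet in
  every coordinate.
\<close>

lemma boxicity_le_card_interval_supergraphs:
  assumes "pair_graph H" and "finite Js"
    and super: "\<And>J. J \<in> Js \<Longrightarrow> interval_supergraph H J"
    and sep: "\<And>u v. \<lbrakk>u \<in> pverts H; v \<in> pverts H; u \<noteq> v; (u, v) \<notin> parcs H\<rbrakk>
                \<Longrightarrow> \<exists>J\<in>Js. separates J u v"
  shows "boxicity H \<le> card Js"
proof -
  interpret pair_graph H by fact
  let ?I = "{..<card Js}"
  obtain f where f: "bij_betw f ?I Js"
    using ex_bij_betw_nat_finite[OF \<open>finite Js\<close>] by (auto simp: atLeast0LessThan)
  then have img: "f ` ?I = Js" by (simp add: bij_betw_def)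
  define B where "B v = (\<Pi>\<^sub>E j\<in>?I. {fst (f j v)..snd (f j v)})" for v
  have "(u, v) \<in> parcs H \<longleftrightarrow> B u \<inter> B v \<noteq> {}"
    if uv: "u \<in> pverts H" "v \<in> pverts H" "u \<noteq> v" for u v
  proof -
    have "B u \<inter> B v
        = (\<Pi>\<^sub>E j\<in>?I. {fst (f j u)..snd (f j u)} \<inter> {fst (f j v)..snd (f j v)})"
      by (simp add: B_def PiE_Int)
    then have meet: "B u \<inter> B v \<noteq> {} \<longleftrightarrow>
        (\<forall>j\<in>?I. {fst (f j u)..snd (f j u)} \<inter> {fst (f j v)..snd (f j v)} \<noteq> {})"
      by (simp add: PiE_eq_empty_iff)
    show ?thesis
    proof
      assume arc: "(u, v) \<in> parcs H"
      have "{fst (f j u)..snd (f j u)} \<inter> {fst (f j v)..snd (f j v)} \<noteq> {}" if "j \<in> ?I" for j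
      proof -
        have "interval_supergraph H (f j)" using super img that by blast
        then have "fst (f j u) \<le> snd (f j u)" "fst (f j v) \<le> snd (f j v)"
          "fst (f j u) \<le> snd (f j v)" "fst (f j v) \<le> snd (f j u)"
          using uv arc arcs_symmetric[OF arc] by (auto simp: interval_supergraph_def)
        then show ?thesis by simp
      qed
      then show "B u \<inter> B v \<noteq> {}" using meet by blast
    next
      assume ne: "B u \<inter> B v \<noteq> {}"
      show "(u, v) \<in> parcs H"
      proof (rule ccontr)
        assume "(u, v) \<notin> parcs H"
        from sep[OF uv this] obtain J where "J \<in> f ` ?I" "separates J u v"
          unfolding img by blast
        then obtain j where "j \<in> ?I" "separates (f j) u v" by blast
        moreover from this(2)
        have "{fst (f j u)..snd (f j u)} \<inter> {fst (f j v)..snd (f j v)} = {}"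
          by (auto simp: separates_def)
        ultimately show False using ne meet by blast
      qed
    qed
  qed
  moreover have "is_box (card Js) (B v)" if "v \<in> pverts H" for v
    unfolding is_box_def B_def
  proof (intro exI conjI allI impI)
    fix j assume "j < card Js"
    then have "interval_supergraph H (f j)" using super img by blast
    then show "fst (f j v) \<le> snd (f j v)" using that by (simp add: interval_supergraph_def)
  qed simp
  ultimately have "box_representation H (card Js) B"
    unfolding box_representation_def by blast
  then show ?thesis unfolding boxicity_def by (blast intro: Least_le)
qed

section \<open>Interval supergraphs of Mycielski graphs\<close>

lemma mycielski_simps:
  "pverts (mycielski G) = {Apex} \<union> Copy1 ` pverts G \<union> Copy2 ` pverts G"
  "(Apex, Apex) \<notin> parcs (mycielski G)"
  "(Apex, Copy1 u) \<notin> parcs (mycielski G)"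
  "(Copy1 u, Apex) \<notin> parcs (mycielski G)"
  "(Apex, Copy2 u) \<in> parcs (mycielski G) \<longleftrightarrow> u \<in> pverts G"
  "(Copy2 u, Apex) \<in> parcs (mycielski G) \<longleftrightarrow> u \<in> pverts G"
  "(Copy1 u, Copy1 v) \<in> parcs (mycielski G) \<longleftrightarrow> (u, v) \<in> parcs G"
  "(Copy1 u, Copy2 v) \<in> parcs (mycielski G) \<longleftrightarrow> (u, v) \<in> parcs G"
  "(Copy2 u, Copy1 v) \<in> parcs (mycielski G) \<longleftrightarrow> (u, v) \<in> parcs G"
  "(Copy2 u, Copy2 v) \<notin> parcs (mycielski G)"
  by (auto simp: mycielski_def)

lemma interval_supergraph_mycielskiI:
  assumes "fst (J Apex) \<le> snd (J Apex)"
    and "\<And>v. v \<in> pverts G \<Longrightarrow> fst (J (Copy1 v)) \<le> snd (J (Copy1 v))"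
    and "\<And>v. v \<in> pverts G \<Longrightarrow> fst (J (Copy2 v)) \<le> snd (J (Copy2 v))"
    and "\<And>v. v \<in> pverts G \<Longrightarrow> fst (J Apex) \<le> snd (J (Copy2 v))"
    and "\<And>v. v \<in> pverts G \<Longrightarrow> fst (J (Copy2 v)) \<le> snd (J Apex)"
    and "\<And>u v. (u, v) \<in> parcs G \<Longrightarrow> fst (J (Copy1 u)) \<le> snd (J (Copy1 v))"
    and "\<And>u v. (u, v) \<in> parcs G \<Longrightarrow> fst (J (Copy1 u)) \<le> snd (J (Copy2 v))"
    and "\<And>u v. (u, v) \<in> parcs G \<Longrightarrow> fst (J (Copy2 u)) \<le> snd (J (Copy1 v))"
  shows "interval_supergraph (mycielski G) J"
  using assms unfolding interval_supergraph_def mycielski_def by auto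

text \<open>
  The parameter \<open>g\<close> gives the vertices distinct positions in \<open>(0, N]\<close>. The second copies of
  vertices outside \<open>S\<close> reach from \<open>0\<close>, where they meet the apex, to the right, where they meet
  the first copies of \<open>S\<close>; they stay clear of the second copies of \<open>S\<close>.
\<close>

fun stable_intervals ::
    "('a \<Rightarrow> real) \<Rightarrow> real \<Rightarrow> 'a set \<Rightarrow> 'a mycielski_vertex \<Rightarrow> real \<times> real" where
  "stable_intervals g N S Apex = (- N, 0)"
| "stable_intervals g N S (Copy1 v) = (if v \<in> S then (g v, g v) else (- N, N))"
| "stable_intervals g N S (Copy2 v) = (if v \<in> S then (- g v, - g v) else (0, N))"

text \<open>
  Stability makes this a supergraph: the points of two vertices of \<open>S\<close> never have to coincide,
  and every other interval extends over all points that it could be required to meet.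
\<close>

lemma interval_supergraph_stable:
  assumes "pair_graph G" and stable: "clique (complement G) S" and N: "0 \<le> N"
    and g: "\<And>v. v \<in> pverts G \<Longrightarrow> 0 < g v \<and> g v \<le> N"
  shows "interval_supergraph (mycielski G) (stable_intervals g N S)"
proof -
  interpret pair_graph G by fact
  have arc: "(u \<notin> S \<or> v \<notin> S) \<and> 0 < g u \<and> g u \<le> N \<and> 0 < g v \<and> g v \<le> N"
    if "(u, v) \<in> parcs G" for u v
  proof -
    have "u \<noteq> v" using that no_loops' by blast
    then show ?thesis
      using that stable in_arcsD1[OF that] in_arcsD2[OF that] g
      by (auto simp: clique_def complement_def)
  qed
  show ?thesis
    by (rule interval_supergraph_mycielskiI) (use N in \<open>auto dest!: arc g split: if_splits\<close>)
qed

text \<open>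
  The vertices \<open>p\<^sub>2, q\<^sub>1, p\<^sub>1, q\<^sub>2\<close> become a path in this order, laid out along \<open>[0, 4]\<close>. All other
  second copies sit at the middle point \<open>2\<close>, where they still meet \<open>p\<^sub>1\<close> and \<open>q\<^sub>1\<close>.
\<close>

fun pair_intervals :: "'a \<Rightarrow> 'a \<Rightarrow> 'a mycielski_vertex \<Rightarrow> real \<times> real" where
  "pair_intervals p q Apex = (1, 3)"
| "pair_intervals p q (Copy1 v) = (if v = p then (2, 3) else if v = q then (1, 2) else (0, 4))"
| "pair_intervals p q (Copy2 v) = (if v = p then (0, 1) else if v = q then (3, 4) else (2, 2))"

lemma interval_supergraph_pair:
  assumes "pair_graph G"
  shows "interval_supergraph (mycielski G) (pair_intervals p q)"
proof -
  interpret pair_graph G by fact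
  show ?thesis
    by (rule interval_supergraph_mycielskiI) (auto dest: no_loops')
qed

text \<open>
  The apex and the first copies of \<open>L\<close> lie at opposite ends, and the second copies bridge the gap.
  Pulling \<open>w\<^sub>1\<close> and \<open>w\<^sub>2\<close> apart costs nothing, because \<open>w\<^sub>1\<close> and \<open>w\<^sub>2\<close> are not adjacent,
  the other first copies still reach back to \<open>w\<^sub>2\<close>, and the other second copies reach up to \<open>w\<^sub>1\<close>.
\<close>

fun apex_intervals :: "'a set \<Rightarrow> 'a \<Rightarrow> 'a mycielski_vertex \<Rightarrow> real \<times> real" where
  "apex_intervals L w Apex = (0, 1)"
| "apex_intervals L w (Copy1 v) = (if v \<notin> L then (0, 3) else if v = w then (3, 3) else (2, 3))"
| "apex_intervals L w (Copy2 v) = (if v = w then (1, 2) else (1, 3))"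

lemma interval_supergraph_apex:
  assumes "pair_graph G"
  shows "interval_supergraph (mycielski G) (apex_intervals L w)"
proof -
  interpret pair_graph G by fact
  show ?thesis
    by (rule interval_supergraph_mycielskiI) (auto dest: no_loops')
qed

section \<open>Clique covers of the complement and the boxicity bound\<close>

lemma minimum_edge_clique_cover:
  assumes "pair_graph H"
  obtains F where "edge_clique_cover H F" "card F = edge_clique_cover_number H"
proof -
  have "\<exists>n F. edge_clique_cover H F \<and> card F = n"
    using edge_clique_cover_exists[OF assms] by blast
  then have "\<exists>F. edge_clique_cover H F \<and> card F = edge_clique_cover_number H"
    unfolding edge_clique_cover_number_def by (rule LeastI_ex)
  with that show ?thesis by blast
qed

lemma non_universal_covered:
  assumes "edge_clique_cover (complement G) F" and "v \<in> pverts G - universal_vertices G"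
  obtains C where "C \<in> F" "v \<in> C"
proof -
  from assms(2) obtain u where "u \<in> pverts G" "u \<noteq> v" "(v, u) \<notin> parcs G"
    by (auto simp: universal_vertices_def)
  then have "(v, u) \<in> parcs (complement G)"
    using assms(2) by (auto simp: complement_def)
  with assms(1) that show ?thesis by (fastforce simp: edge_clique_cover_def)
qed

text \<open>
  Pairing up consecutive elements of an enumeration; the last element may or may not belong to a
  pair, according to parity.
\<close>

lemma finite_set_pairing:
  assumes "finite L" and "L \<noteq> {}"
  obtains P w where "finite P" "card P \<le> card L div 2"
    and "\<And>p q. (p, q) \<in> P \<Longrightarrow> p \<noteq> q"
    and "\<And>x. x \<in> L \<Longrightarrow> x = w \<or> (\<exists>y. (x, y) \<in> P \<or> (y, x) \<in> P)"
proof -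
  obtain f where f: "bij_betw f {..<card L} L"
    using ex_bij_betw_nat_finite[OF assms(1)] by (auto simp: atLeast0LessThan)
  define P where "P = (\<lambda>i. (f (2 * i), f (2 * i + 1))) ` {..<card L div 2}"
  have "p \<noteq> q" if "(p, q) \<in> P" for p q
  proof -
    from that obtain i where i: "i < card L div 2" "p = f (2 * i)" "q = f (2 * i + 1)"
      by (auto simp: P_def)
    have "inj_on f {..<card L}" using f by (simp add: bij_betw_def)
    moreover have "2 * i + 1 < card L" using i(1) by presburger
    ultimately show ?thesis unfolding i(2,3) by (subst inj_on_eq_iff) auto
  qed
  moreover have "x = f (card L - 1) \<or> (\<exists>y. (x, y) \<in> P \<or> (y, x) \<in> P)" if "x \<in> L" for x
  proof -
    have "x \<in> f ` {..<card L}" using that f by (simp add: bij_betw_def)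
    then obtain j where j: "j < card L" "x = f j" by blast
    show ?thesis
    proof (cases "j div 2 < card L div 2")
      case True
      then have "(f (2 * (j div 2)), f (2 * (j div 2) + 1)) \<in> P" by (auto simp: P_def)
      moreover have "j = 2 * (j div 2) \<or> j = 2 * (j div 2) + 1" by presburger
      ultimately show ?thesis using j by metis
    next
      case False
      with j have "j = card L - 1" by presburger
      with j show ?thesis by simp
    qed
  qed
  moreover have "card P \<le> card L div 2"
    unfolding P_def by (rule order_trans[OF card_image_le]) simp_all
  moreover have "finite P" by (simp add: P_def)
  ultimately show ?thesis using that by blast
qed

text \<open>
  The supergraphs of stable sets take care of every non-edge with a non-universal vertex of \<open>G\<close>
  behind one of its ends, so only the non-edges above universal vertices remain as an obligation.
\<close>

lemma boxicity_mycielski_le_cover: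
  assumes G: "pair_graph G" and cover: "edge_clique_cover (complement G) F"
    and fin: "finite K" and K: "\<And>J. J \<in> K \<Longrightarrow> interval_supergraph (mycielski G) J"
    and apex: "\<And>u. u \<in> universal_vertices G \<Longrightarrow> \<exists>J\<in>K. separates J Apex (Copy1 u)"
    and copies: "\<And>u. u \<in> universal_vertices G \<Longrightarrow> \<exists>J\<in>K. separates J (Copy1 u) (Copy2 u)"
    and second: "\<And>u v. \<lbrakk>u \<in> universal_vertices G; v \<in> universal_vertices G; u \<noteq> v\<rbrakk>
                   \<Longrightarrow> \<exists>J\<in>K. separates J (Copy2 u) (Copy2 v)"
  shows "boxicity (mycielski G) \<le> card F + card K"
proof -
  interpret pair_graph G by fact
  let ?L = "universal_vertices G"
  obtain h :: "'a \<Rightarrow> nat" and n where h: "h ` pverts G = {i. i < n}" "inj_on h (pverts G)"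
    using finite_imp_inj_to_nat_seg[OF pair_finite_verts] by blast
  define g where "g v = real (h v) + 1" for v
  have g: "0 < g v \<and> g v \<le> real n" if "v \<in> pverts G" for v
  proof -
    have "h v < n" using h(1) that by blast
    then show ?thesis by (simp add: g_def)
  qed
  have g_inj: "g u \<noteq> g v" if "u \<in> pverts G" "v \<in> pverts G" "u \<noteq> v" for u v
    using inj_on_eq_iff[OF h(2) that(1,2)] that(3) by (simp add: g_def)
  let ?st = "stable_intervals g (real n)"
  define Js where "Js = ?st ` F \<union> K"
  have F: "finite F" "\<And>C. C \<in> F \<Longrightarrow> clique (complement G) C"
    using cover by (auto simp: edge_clique_cover_def)
  have CV: "C \<subseteq> pverts G" if "C \<in> F" for C
    using F(2)[OF that] by (simp add: clique_def complement_def)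
  have covered: "\<exists>C\<in>F. u \<in> C" if "u \<in> pverts G" "u \<notin> ?L" for u
    using non_universal_covered[OF cover, of u] that by blast
  have nonadj: "\<exists>C\<in>F. u \<in> C \<and> v \<in> C"
    if "u \<in> pverts G" "v \<in> pverts G" "u \<noteq> v" "(u, v) \<notin> parcs G" for u v
  proof -
    have "(u, v) \<in> parcs (complement G)" using that by (simp add: complement_def)
    then show ?thesis using cover by (auto simp: edge_clique_cover_def)
  qed
  have z1: "\<exists>J\<in>Js. separates J Apex (Copy1 u)" if u: "u \<in> pverts G" for u
  proof (cases "u \<in> ?L")
    case True
    with apex show ?thesis by (auto simp: Js_def)
  next
    case False
    with covered u obtain C where "C \<in> F" "u \<in> C" by blast
    then have "separates (?st C) Apex (Copy1 u)" using g[OF u] by (simp add: separates_def)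
    with \<open>C \<in> F\<close> show ?thesis by (auto simp: Js_def)
  qed
  have s11: "\<exists>J\<in>Js. separates J (Copy1 u) (Copy1 v)"
    if uv: "u \<in> pverts G" "v \<in> pverts G" "u \<noteq> v" "(u, v) \<notin> parcs G" for u v
  proof -
    from nonadj[OF uv] obtain C where "C \<in> F" "u \<in> C" "v \<in> C" by blast
    then have "separates (?st C) (Copy1 u) (Copy1 v)"
      using g_inj[OF uv(1-3)] by (auto simp: separates_def)
    with \<open>C \<in> F\<close> show ?thesis by (auto simp: Js_def)
  qed
  have s12: "\<exists>J\<in>Js. separates J (Copy1 u) (Copy2 v)"
    if uv: "u \<in> pverts G" "v \<in> pverts G" "(u, v) \<notin> parcs G" for u v
  proof (cases "u = v \<and> u \<in> ?L")
    case True
    with copies show ?thesis by (auto simp: Js_def)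
  next
    case False
    then obtain C where "C \<in> F" "u \<in> C" "v \<in> C"
      using nonadj[OF uv(1,2)] covered uv by blast
    then have "separates (?st C) (Copy1 u) (Copy2 v)"
      using g[OF uv(1)] g[OF uv(2)] by (simp add: separates_def)
    with \<open>C \<in> F\<close> show ?thesis by (auto simp: Js_def)
  qed
  have s22': "\<exists>J\<in>Js. separates J (Copy2 u) (Copy2 v)"
    if uv: "u \<in> pverts G" "v \<in> pverts G" "u \<noteq> v" "u \<notin> ?L" for u v
  proof -
    from covered uv obtain C where "C \<in> F" "u \<in> C" by blast
    then have "separates (?st C) (Copy2 u) (Copy2 v)"
      using g[OF uv(1)] g_inj[OF uv(1-3)] by (auto simp: separates_def)
    with \<open>C \<in> F\<close> show ?thesis by (auto simp: Js_def)
  qed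
  have s22: "\<exists>J\<in>Js. separates J (Copy2 u) (Copy2 v)"
    if uv: "u \<in> pverts G" "v \<in> pverts G" "u \<noteq> v" for u v
  proof (cases "u \<in> ?L \<and> v \<in> ?L")
    case True
    with second[of u v] uv show ?thesis unfolding Js_def by blast
  next
    case False
    with s22'[of u v] s22'[of v u] uv show ?thesis by (auto simp: separates_sym)
  qed
  have "boxicity (mycielski G) \<le> card Js"
  proof (rule boxicity_le_card_interval_supergraphs)
    show "pair_graph (mycielski G)" by (rule pair_graph_mycielski[OF G])
    show "finite Js" using F(1) fin by (simp add: Js_def)
    show "interval_supergraph (mycielski G) J" if "J \<in> Js" for J
      using that K interval_supergraph_stable[OF G F(2) _ g] by (auto simp: Js_def)
    fix x y
    assume xy: "x \<in> pverts (mycielski G)" "y \<in> pverts (mycielski G)" "x \<noteq> y"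
      "(x, y) \<notin> parcs (mycielski G)"
    show "\<exists>J\<in>Js. separates J x y"
    proof (cases x; cases y)
      fix u v assume [simp]: "x = Copy2 u" "y = Copy1 v"
      have "(v, u) \<notin> parcs G" using xy arcs_symmetric by (auto simp: mycielski_simps)
      then show ?thesis using xy s12[of v u] by (auto simp: mycielski_simps separates_sym)
    next
      fix u assume [simp]: "x = Copy1 u" "y = Apex"
      show ?thesis using xy z1[of u] by (auto simp: mycielski_simps separates_sym)
    qed (use xy z1 s11 s12 s22 in \<open>auto simp: mycielski_simps\<close>)
  qed
  also have "\<dots> \<le> card F + card K"
    unfolding Js_def by (meson F(1) add_right_mono card_Un_le card_image_le order_trans)
  finally show ?thesis .
qed

theorem theorem4p3:
  fixes G :: "'a pair_pre_digraph" and l :: nat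
  assumes "pair_graph G"
    and "l = card (universal_vertices G)"
  shows "int (boxicity (mycielski G))
           \<le> int (edge_clique_cover_number (complement G)) + \<lceil>real l / 2\<rceil> + 1
       \<and> (l = 0 \<or> odd l \<longrightarrow>
           int (boxicity (mycielski G))
             \<le> int (edge_clique_cover_number (complement G)) + \<lceil>real l / 2\<rceil>)"
proof -
  interpret pair_graph G by fact
  let ?L = "universal_vertices G" and ?\<theta> = "edge_clique_cover_number (complement G)"
  have finL: "finite ?L"
    by (rule finite_subset[OF _ pair_finite_verts]) (auto simp: universal_vertices_def)
  obtain F where F: "edge_clique_cover (complement G) F" "card F = ?\<theta>"
    using minimum_edge_clique_cover[OF pair_graph_complement[OF assms(1)]] .
  note reduce = boxicity_mycielski_le_cover[OF assms(1) F(1), unfolded F(2)]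
  have ceil: "\<lceil>real l / 2\<rceil> = int ((l + 1) div 2)"
    by linarith
  show ?thesis
  proof (cases "?L = {}")
    case True
    then have "boxicity (mycielski G) \<le> ?\<theta>"
      using reduce[of "{}"] by simp
    then show ?thesis by (simp add: ceil)
  next
    case False
    obtain P w where P: "finite P" "card P \<le> card ?L div 2"
      and neq: "\<And>p q. (p, q) \<in> P \<Longrightarrow> p \<noteq> q"
      and pairs: "\<And>x. x \<in> ?L \<Longrightarrow> x = w \<or> (\<exists>y. (x, y) \<in> P \<or> (y, x) \<in> P)"
      using finite_set_pairing[OF finL False] by blast
    define K where "K = insert (apex_intervals ?L w) ((\<lambda>(p, q). pair_intervals p q) ` P)"
    have pair_in_K: "pair_intervals p q \<in> K" if "(p, q) \<in> P" for p q
      using imageI[OF that, of "\<lambda>(p, q). pair_intervals p q"] by (simp add: K_def)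
    have second: "\<exists>J\<in>K. separates J (Copy2 u) (Copy2 v)"
      if u: "u \<in> ?L" "u \<noteq> w" and "u \<noteq> v" for u v
    proof -
      from pairs u obtain y where "(u, y) \<in> P \<or> (y, u) \<in> P" by blast
      then show ?thesis
      proof
        assume y: "(u, y) \<in> P"
        then have "separates (pair_intervals u y) (Copy2 u) (Copy2 v)"
          using \<open>u \<noteq> v\<close> by (auto simp: separates_def)
        with pair_in_K[OF y] show ?thesis by blast
      next
        assume y: "(y, u) \<in> P"
        then have "separates (pair_intervals y u) (Copy2 u) (Copy2 v)"
          using \<open>u \<noteq> v\<close> neq[OF y] by (auto simp: separates_def)
        with pair_in_K[OF y] show ?thesis by blast
      qed
    qed
    have "boxicity (mycielski G) \<le> ?\<theta> + card K"
    proof (rule reduce)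
      show "finite K" using P(1) by (simp add: K_def)
      show "interval_supergraph (mycielski G) J" if "J \<in> K" for J
        using that interval_supergraph_pair[OF assms(1)] interval_supergraph_apex[OF assms(1)]
        by (auto simp: K_def)
      show "\<exists>J\<in>K. separates J Apex (Copy1 u)" if "u \<in> ?L" for u
        using that by (auto simp: K_def separates_def)
      show "\<exists>J\<in>K. separates J (Copy1 u) (Copy2 u)" if u: "u \<in> ?L" for u
        using pairs[OF u]
      proof (elim disjE exE)
        assume "u = w"
        with u show ?thesis by (auto simp: K_def separates_def)
      next
        fix y assume y: "(u, y) \<in> P"
        then have "separates (pair_intervals u y) (Copy1 u) (Copy2 u)"
          by (auto simp: separates_def)
        with pair_in_K[OF y] show ?thesis by blast
      next
        fix y assume y: "(y, u) \<in> P"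
        then have "separates (pair_intervals y u) (Copy1 u) (Copy2 u)"
          using neq[OF y] by (auto simp: separates_def)
        with pair_in_K[OF y] show ?thesis by blast
      qed
      show "\<exists>J\<in>K. separates J (Copy2 u) (Copy2 v)"
        if uv: "u \<in> ?L" "v \<in> ?L" "u \<noteq> v" for u v
      proof (cases "u = w")
        case True
        with uv second[of v u] show ?thesis by (auto simp: separates_sym)
      qed (use second uv in blast)
    qed
    moreover have "card K \<le> l div 2 + 1"
    proof -
      have "card K \<le> Suc (card ((\<lambda>(p, q). pair_intervals p q) ` P))"
        unfolding K_def by (rule card_insert_le_m1) auto
      also have "\<dots> \<le> Suc (card P)" using card_image_le[OF P(1)] by simp
      finally show ?thesis using P(2) assms(2) by simp
    qed
    moreover have "l \<noteq> 0" using False finL assms(2) by simp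
    ultimately show ?thesis
      unfolding ceil by presburger
  qed
qed

end
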